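(* For all real symmetric $2d\times 2d$ matrices $C$ and $D$, $$\mathbb{E}_{P,S\in A_d}\det\left(xI-C-(P\oplus S)D(P\oplus S)^T\right)=\mathbb{E}_{Q,R\in O(d)}\det\left(xI-C-(Q\oplus R)D(Q\oplus R)^T\right),$$ where $P,S$ are independent and uniform on $A_d$, and $Q,R$ are independent Haar-random elements of $O(d)$.
   Context: $X\oplus Y$ denotes the block diagonal matrix $\begin{bmatrix}X&0\\0&Y\end{bmatrix}$. $A_d$ denotes the group of orthogonal transformations of $\mathbb{R}^d$ that permute the vertices of a fixed regular simplex in $\mathbb{R}^d$ (with $d+1$ vertices, centered at the origin); it is a finite subgroup of the orthogonal group $O(d)$. *)

theory Defs
  imports "HOL-Analysis.Analysis" "HOL-Probability.Probability"
begin

text \<open>A square matrix of size \<open>d\<close> is indexed by a finite type \<open>'n\<close> with \<open>CARD('n) = d\<close>; a matrix of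
  size \<open>2d\<close> is then indexed by the sum type \<open>'n + 'n\<close>, with \<open>Inl\<close> and \<open>Inr\<close> selecting the two blocks.\<close>

definition block_diag ::
  "'a::zero^'n^'n \<Rightarrow> 'a^'m^'m \<Rightarrow> 'a^('n + 'm)^('n + 'm)" (infixr \<open>\<oplus>\<^sub>d\<close> 65) where
  "X \<oplus>\<^sub>d Y = (\<chi> i j. case (i, j) of
      (Inl a, Inl b) \<Rightarrow> X $ a $ b
    | (Inr a, Inr b) \<Rightarrow> Y $ a $ b
    | _ \<Rightarrow> 0)"

definition orthogonal_group :: "(real^'n^'n) set" where
  "orthogonal_group = {Q. orthogonal_matrix Q}"

text \<open>Vertex sets of regular simplices in \<open>\<real>\<^sup>d\<close> with barycentre at the origin.\<close>

definition regular_simplex_vertices :: "(real^'n) set \<Rightarrow> bool" where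
  "regular_simplex_vertices V \<longleftrightarrow>
     finite V \<and> card V = CARD('n) + 1 \<and> \<not> affine_dependent V \<and>
     (\<exists>s. \<forall>u\<in>V. \<forall>v\<in>V. u \<noteq> v \<longrightarrow> dist u v = s) \<and>
     (\<Sum>v\<in>V. v) = 0"

definition simplex_group :: "(real^'n) set \<Rightarrow> (real^'n^'n) set" where
  "simplex_group V = {P \<in> orthogonal_group. (*v) P ` V = V}"

text \<open>The normalised Haar measure on the compact group \<open>O(d)\<close> is the unique left-invariant Borel
  probability measure on it (it is then also right-invariant). It is characterised here by a
  predicate on measures.\<close>

definition haar_orthogonal :: "(real^'n^'n) measure \<Rightarrow> bool" where
  "haar_orthogonal \<mu> \<longleftrightarrow>
     prob_space \<mu> \<and>
     space \<mu> = orthogonal_group \<and>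
     sets \<mu> = sets (restrict_space borel orthogonal_group) \<and>
     (\<forall>G\<in>orthogonal_group. distr \<mu> \<mu> (\<lambda>Q. G ** Q) = \<mu>)"

end

theory Submission
  imports Defs
begin

text \<open>
  Conjugating one side of \<open>det (A - W B W\<^sup>T)\<close> by a rotation \<open>W\<close> through an angle \<open>\<theta>\<close> in a fixed
  plane gives a trigonometric polynomial in \<open>\<theta>\<close> of degree at most 2, so its average over the three
  rotations by multiples of \<open>2\<pi>/3\<close> does not depend on \<open>\<theta>\<close>. The simplex group contains these three
  rotations in the plane of any triangle of vertices. Hence, if \<open>f\<close> is such a determinant as a function
  of one block, the average \<open>g(Q)\<close> of \<open>f(P Q)\<close> over \<open>P\<close> in the simplex group is invariant under left
  multiplication of \<open>Q\<close> by the simplex group and by all rotations in the planes of vertex triangles.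
  The closed group formed by all such invariances acts transitively on directions, so it contains
  all reflections, so it is \<open>O(d)\<close>. Thus \<open>g\<close> is constant, and integrating it against the Haar measure
  identifies the constant with the integral of \<open>f\<close>. Treating the two blocks one after the other and
  applying Fubini gives the theorem.
\<close>

section \<open>Determinants and rank-one updates\<close>

definition outer_product :: "'a::times^'m \<Rightarrow> 'a^'n \<Rightarrow> 'a^'n^'m" where
  "outer_product x y = (\<chi> i j. x $ i * y $ j)"

text \<open>Row k lies outside S and stays unchanged through the induction, so each step is one
  elementary row operation.\<close>

lemma det_add_multiples_of_row:
  fixes A :: "'a::comm_ring_1^'n^'n"
  assumes "finite S" "k \<notin> S"
  shows "det (\<chi> i. if i \<in> S then A $ i + c i *s A $ k else A $ i) = det A"
  using assms
proof (induction S)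
  case empty
  then show ?case by simp
next
  case (insert j S)
  let ?B = "\<chi> i. if i \<in> S then A $ i + c i *s A $ k else A $ i"
  have "det (\<chi> i. if i = j then row j ?B + c j *s row k ?B else row i ?B) = det ?B"
    using insert by (intro det_row_operation) auto
  moreover have "(\<chi> i. if i = j then row j ?B + c j *s row k ?B else row i ?B)
      = (\<chi> i. if i \<in> insert j S then A $ i + c i *s A $ k else A $ i)"
    using insert by (auto simp: vec_eq_iff row_def)
  ultimately show ?case
    using insert by simp
qed

text \<open>Rows are updated one at a time. By linearity in row k the determinant splits; once row k
  has become y, the updates of the other rows are multiples of it and can be undone. So t occurs
  only to the first power.\<close>

lemma det_add_outer_product_rows:
  fixes A :: "'a::comm_ring_1^'n^'n"
  assumes "finite S"
  shows "det (\<chi> i. if i \<in> S then A $ i + (t * x $ i) *s y else A $ i)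
       = det A + t * (\<Sum>k\<in>S. x $ k * det (\<chi> i. if i = k then y else A $ i))"
  using assms
proof (induction S)
  case empty
  then show ?case by simp
next
  case (insert k S)
  let ?B = "\<lambda>S. \<chi> i. if i \<in> S then A $ i + (t * x $ i) *s y else A $ i"
  let ?R = "\<chi> i. if i = k then y else A $ i"
  have "?B (insert k S) = (\<chi> i. if i = k then A $ k + (t * x $ k) *s y else ?B S $ i)"
    using insert by (auto simp: vec_eq_iff)
  then have "det (?B (insert k S)) = det (\<chi> i. if i = k then A $ k else ?B S $ i)
      + (t * x $ k) * det (\<chi> i. if i = k then y else ?B S $ i)"
    by (simp only: det_row_add[of k "\<lambda>_. A $ k" "\<lambda>_. (t * x $ k) *s y"]
        det_row_mul[of k "t * x $ k" "\<lambda>_. y"])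
  also have "(\<chi> i. if i = k then A $ k else ?B S $ i) = ?B S"
    using insert by (auto simp: vec_eq_iff)
  also have "(\<chi> i. if i = k then y else ?B S $ i)
      = (\<chi> i. if i \<in> S then ?R $ i + (t * x $ i) *s ?R $ k else ?R $ i)"
    using insert by (auto simp: vec_eq_iff)
  also have "det \<dots> = det ?R"
    using insert by (intro det_add_multiples_of_row) auto
  finally show ?case
    using insert by (simp add: algebra_simps)
qed

lemma det_add_outer_product:
  fixes A :: "'a::comm_ring_1^'n^'n"
  shows "det (A + outer_product (t *s x) y)
       = det A + t * (\<Sum>k\<in>UNIV. x $ k * det (\<chi> i. if i = k then y else A $ i))"
proof -
  have "A + outer_product (t *s x) y
      = (\<chi> i. if i \<in> UNIV then A $ i + (t * x $ i) *s y else A $ i)"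
    by (simp add: vec_eq_iff outer_product_def)
  then show ?thesis
    by (simp only: det_add_outer_product_rows[OF finite_class.finite_UNIV])
qed

text \<open>Interpolation between t = 0 and t = 1, the form in which
  \<open>cube_root_sum_multiaffine\<close> expects affinity. The factors \<open>0 *s\<close> and
  \<open>1 *s\<close> stay unsimplified so that all three determinants are values of one function of
  t.\<close>

lemma det_add_outer_product_affine:
  fixes A :: "'a::comm_ring_1^'n^'n"
  shows "det (A + outer_product (t *s x) y)
       = (1 - t) * det (A + outer_product (0 *s x) y) + t * det (A + outer_product (1 *s x) y)"
  unfolding det_add_outer_product by (simp add: algebra_simps)

text \<open>On \<open>(z, z, z\<^sup>-\<^sup>1, z\<^sup>-\<^sup>1)\<close> a multiaffine function is a Laurent polynomial with exponents
  between \<open>-2\<close> and \<open>2\<close>; summing over the third roots of unity removes all exponents but 0.\<close>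

lemma cube_root_sum_multiaffine:
  fixes \<Phi> :: "complex \<Rightarrow> complex \<Rightarrow> complex \<Rightarrow> complex \<Rightarrow> complex"
  assumes affine1: "\<And>a b c d. \<Phi> a b c d = (1 - a) * \<Phi> 0 b c d + a * \<Phi> 1 b c d"
    and affine2: "\<And>a b c d. \<Phi> a b c d = (1 - b) * \<Phi> a 0 c d + b * \<Phi> a 1 c d"
    and affine3: "\<And>a b c d. \<Phi> a b c d = (1 - c) * \<Phi> a b 0 d + c * \<Phi> a b 1 d"
    and affine4: "\<And>a b c d. \<Phi> a b c d = (1 - d) * \<Phi> a b c 0 + d * \<Phi> a b c 1"
    and root: "w\<^sup>2 + w + 1 = 0"
  shows "\<exists>K. \<forall>z. z \<noteq> 0 \<longrightarrow>
    (\<Sum>j<3. \<Phi> (w ^ j * z) (w ^ j * z) (inverse (w ^ j * z)) (inverse (w ^ j * z))) = K"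
proof -
  \<comment> \<open>\<open>p i c d\<close> is the coefficient of \<open>z ^ i\<close> in
    \<open>\<Phi> z z c d\<close>, read off from the corner values in the first two
    arguments.\<close>
  define p where "p i c d = (if i = 0 then \<Phi> 0 0 c d
      else if i = 1 then \<Phi> 1 0 c d + \<Phi> 0 1 c d - 2 * \<Phi> 0 0 c d
      else \<Phi> 1 1 c d - \<Phi> 1 0 c d - \<Phi> 0 1 c d + \<Phi> 0 0 c d)" for i :: nat and c d
  have p: "\<Phi> z z c d = p 0 c d + p 1 c d * z + p 2 c d * z\<^sup>2" for z c d
    by (subst affine1, subst (1 2) affine2) (simp add: p_def algebra_simps power2_eq_square)
  \<comment> \<open>Likewise, \<open>q i k\<close> is the coefficient of \<open>y ^ k\<close> in
    \<open>p i y y\<close>.\<close>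
  define q where "q i k = (if k = 0 then p i 0 0
      else if k = 1 then p i 1 0 + p i 0 1 - 2 * p i 0 0
      else p i 1 1 - p i 1 0 - p i 0 1 + p i 0 0)" for i k :: nat
  have \<Phi>4: "\<Phi> a b y y = (1 - y) * (1 - y) * \<Phi> a b 0 0 + (1 - y) * y * \<Phi> a b 0 1
      + y * (1 - y) * \<Phi> a b 1 0 + y * y * \<Phi> a b 1 1" for a b y
    by (subst affine3, subst (1 2) affine4) (simp add: algebra_simps)
  have q: "p i y y = q i 0 + q i 1 * y + q i 2 * y\<^sup>2" for i y
    by (simp add: q_def p_def \<Phi>4[of _ _ y] algebra_simps power2_eq_square)
  have w3: "w ^ 3 = 1"
  proof -
    have "w ^ 3 - 1 = (w - 1) * (w\<^sup>2 + w + 1)"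
      by (simp add: algebra_simps power2_eq_square power3_eq_cube)
    then show ?thesis
      using root by simp
  qed
  have w0: "w \<noteq> 0"
    using root by auto
  have invw: "inverse w = w\<^sup>2"
    using w3 w0 by (simp add: field_simps power2_eq_square power3_eq_cube)
  have invw2: "inverse (w\<^sup>2) = w"
    using w3 w0 by (simp add: field_simps power2_eq_square power3_eq_cube)
  have w2: "w\<^sup>2 = - 1 - w"
  proof -
    have "w\<^sup>2 = (w\<^sup>2 + w + 1) - 1 - w" by simp
    then show ?thesis unfolding root by simp
  qed
  have "(\<Sum>j<3. \<Phi> (w ^ j * z) (w ^ j * z) (inverse (w ^ j * z)) (inverse (w ^ j * z)))
      = 3 * (q 0 0 + q 1 1 + q 2 2)" if z: "z \<noteq> 0" for z
  proof -
    \<comment> \<open>The expansion of \<open>\<Phi> z z y y\<close> with each product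
      \<open>z * y\<close> replaced by 1; the two differ by a multiple of
      \<open>z * y - 1\<close>.\<close>
    define f where "f z y = (q 0 0 + q 1 1 + q 2 2) + (q 1 0 + q 2 1) * z + (q 0 1 + q 1 2) * y
        + q 2 0 * z\<^sup>2 + q 0 2 * y\<^sup>2" for z y
    have f: "\<Phi> z z y y = f z y" if "z * y = 1" for z y
    proof -
      have "\<Phi> z z y y = f z y + (q 1 1 + q 2 1 * z + q 1 2 * y + q 2 2 * (z * y + 1)) * (z * y - 1)"
        unfolding p q f_def by (simp add: algebra_simps power2_eq_square)
      then show ?thesis
        using that by simp
    qed
    \<comment> \<open>Since \<open>w ^ 3 = 1\<close>, the inverse of w is \<open>w\<^sup>2\<close>.
      Every nonconstant monomial picks up the factors 1, w and \<open>w\<^sup>2\<close> in some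
      order, and these add up to 0.\<close>
    have sum: "f z y + f (w * z) (w\<^sup>2 * y) + f (w\<^sup>2 * z) (w * y) = 3 * (q 0 0 + q 1 1 + q 2 2)" for z y
    proof -
      have 1: "(w\<^sup>2)\<^sup>2 = w"
        using w3 by (simp add: power2_eq_square power3_eq_cube algebra_simps)
      show ?thesis
        unfolding f_def power_mult_distrib 1 unfolding w2 by (simp add: algebra_simps)
    qed
    have set3: "{..<3} = {0, 1, 2 :: nat}"
      by auto
    have "w * z * (w\<^sup>2 * inverse z) = w ^ 3 * (z * inverse z)"
      "w\<^sup>2 * z * (w * inverse z) = w ^ 3 * (z * inverse z)"
      by (simp_all add: power2_eq_square power3_eq_cube)
    then have "w * z * (w\<^sup>2 * inverse z) = 1" "w\<^sup>2 * z * (w * inverse z) = 1"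
      using w3 z by simp_all
    then show ?thesis
      using z f[of z "inverse z"] f[of "w * z" "w\<^sup>2 * inverse z"] f[of "w\<^sup>2 * z" "w * inverse z"]
        sum[of z "inverse z"]
      unfolding set3 by (simp add: invw invw2 add.assoc)
  qed
  then show ?thesis by blast
qed

section \<open>Plane rotations\<close>

lemma matrix_add_rdistrib: "(A + B) ** C = A ** C + B ** C"
  for A :: "'a::semiring_1^'n^'m"
  by (simp add: matrix_matrix_mult_def vec_eq_iff distrib_right sum.distrib)

lemma matrix_diff_rdistrib: "(A - B) ** C = A ** C - B ** C"
  for A :: "'a::ring_1^'n^'m"
  by (simp add: matrix_matrix_mult_def vec_eq_iff left_diff_distrib sum_subtractf)

lemma matrix_diff_ldistrib: "A ** (B - C) = A ** B - A ** C"
  for A :: "'a::ring_1^'n^'m"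
  by (simp add: matrix_matrix_mult_def vec_eq_iff right_diff_distrib sum_subtractf)

lemma outer_product_mult_vec:
  fixes x :: "real^'m" and y :: "real^'n"
  shows "outer_product x y *v v = (y \<bullet> v) *\<^sub>R x"
  by (simp add: outer_product_def vec_eq_iff matrix_vector_mult_def inner_vec_def
      sum_distrib_left sum_distrib_right mult_ac)

lemma matrix_mult_outer_product:
  fixes A :: "'a::comm_semiring_1^'n^'m"
  shows "A ** outer_product x y = outer_product (A *v x) y"
  by (simp add: outer_product_def vec_eq_iff matrix_matrix_mult_def matrix_vector_mult_def
      sum_distrib_left mult_ac)

lemma outer_product_matrix_mult:
  fixes B :: "'a::comm_semiring_1^'n^'m"
  shows "outer_product x y ** B = outer_product x (y v* B)"
  by (simp add: outer_product_def vec_eq_iff matrix_matrix_mult_def vector_matrix_mult_def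
      sum_distrib_left mult_ac)

text \<open>For an orthonormal pair this sends a to
  \<open>cos \<theta> *\<^sub>R a + sin \<theta> *\<^sub>R b\<close> and fixes the orthogonal
  complement of the plane.\<close>

definition plane_rotation :: "real^'n \<Rightarrow> real^'n \<Rightarrow> real \<Rightarrow> real^'n^'n" where
  "plane_rotation a b \<theta> = mat 1 + (cos \<theta> - 1) *\<^sub>R (outer_product a a + outer_product b b)
     + sin \<theta> *\<^sub>R (outer_product b a - outer_product a b)"

definition orthonormal_pair :: "real^'n \<Rightarrow> real^'n \<Rightarrow> bool" where
  "orthonormal_pair a b \<longleftrightarrow> a \<bullet> a = 1 \<and> b \<bullet> b = 1 \<and> a \<bullet> b = 0"

lemma plane_rotation_mult_vec:
  "plane_rotation a b \<theta> *v v = v + ((cos \<theta> - 1) * (a \<bullet> v) - sin \<theta> * (b \<bullet> v)) *\<^sub>R a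
     + ((cos \<theta> - 1) * (b \<bullet> v) + sin \<theta> * (a \<bullet> v)) *\<^sub>R b"
  by (simp add: plane_rotation_def matrix_vector_mult_add_rdistrib matrix_vector_mult_diff_rdistrib
      outer_product_mult_vec scaleR_matrix_vector_assoc[symmetric] algebra_simps)

lemma plane_rotation_0: "plane_rotation a b 0 = mat 1"
  by (simp add: plane_rotation_def)

lemma transpose_plane_rotation: "transpose (plane_rotation a b \<theta>) = plane_rotation a b (- \<theta>)"
  by (simp add: plane_rotation_def transpose_def vec_eq_iff outer_product_def mat_def algebra_simps)

lemma plane_rotation_add:
  assumes "orthonormal_pair a b"
  shows "plane_rotation a b \<alpha> ** plane_rotation a b \<beta> = plane_rotation a b (\<alpha> + \<beta>)"
proof -
  have *: "a \<bullet> a = 1" "b \<bullet> b = 1" "a \<bullet> b = 0" "b \<bullet> a = 0"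
    using assms by (auto simp: orthonormal_pair_def inner_commute)
  show ?thesis
    unfolding matrix_eq matrix_vector_mul_assoc[symmetric] plane_rotation_mult_vec
    by (simp add: inner_add_right * cos_add sin_add algebra_simps)
qed

lemma orthogonal_plane_rotation:
  assumes "orthonormal_pair a b"
  shows "orthogonal_matrix (plane_rotation a b \<theta>)"
  by (simp add: orthogonal_matrix transpose_plane_rotation plane_rotation_add[OF assms]
      plane_rotation_0)

text \<open>The rotation is the square of the rotation by half the angle, whose determinant is 1 or
  -1.\<close>

lemma det_plane_rotation:
  assumes "orthonormal_pair a b"
  shows "det (plane_rotation a b \<theta>) = 1"
proof -
  have "det (plane_rotation a b \<theta>) = det (plane_rotation a b (\<theta>/2)) * det (plane_rotation a b (\<theta>/2))"
    by (simp add: det_mul[symmetric] plane_rotation_add[OF assms])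
  then show ?thesis
    using det_orthogonal_matrix[OF orthogonal_plane_rotation[OF assms, of "\<theta>/2"]] by auto
qed

lemma of_real_det: "of_real (det A) = det (map_matrix of_real A)"
  for A :: "real^'n^'n"
  by (simp add: det_def map_matrix_def)

text \<open>Multiplying on the right by the rotation, of determinant 1, cancels the transpose and
  leaves a matrix that is linear in the rotation.\<close>

lemma det_conj_plane_rotation:
  fixes A B :: "real^'n^'n"
  assumes "orthonormal_pair a b"
  shows "det (A - plane_rotation a b \<theta> ** B ** transpose (plane_rotation a b \<theta>))
    = det (A ** plane_rotation a b \<theta> - plane_rotation a b \<theta> ** B)"
proof -
  let ?W = "plane_rotation a b \<theta>"
  have "(A - ?W ** B ** transpose ?W) ** ?W = A ** ?W - ?W ** B"
    using orthogonal_plane_rotation[OF assms, of \<theta>]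
    by (simp add: matrix_diff_rdistrib orthogonal_matrix matrix_mul_assoc[symmetric])
  then have "det (A ** ?W - ?W ** B) = det (A - ?W ** B ** transpose ?W) * det ?W"
    by (metis det_mul)
  then show ?thesis
    by (simp add: det_plane_rotation[OF assms])
qed

text \<open>Over the complex numbers the angle enters only through \<open>cis \<theta>\<close> and
  its inverse, as coefficients of rank-one terms in which the determinant is multiaffine. Third
  turns multiply \<open>cis \<theta>\<close> by the cube roots of unity.\<close>

lemma plane_rotation_third_turn_sum:
  fixes A B :: "real^'n^'n"
  assumes "orthonormal_pair a b"
  shows "(\<Sum>j<3. det (A - plane_rotation a b (\<theta> + 2 * pi * real j / 3) ** B
                        ** transpose (plane_rotation a b (\<theta> + 2 * pi * real j / 3))))
       = (\<Sum>j<3. det (A - plane_rotation a b (2 * pi * real j / 3) ** B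
                        ** transpose (plane_rotation a b (2 * pi * real j / 3))))"
proof -
  let ?c = "map_matrix complex_of_real"
  define p where "p = (\<chi> i. Complex (a $ i) (- b $ i))"
  define q where "q = (\<chi> i. Complex (a $ i) (b $ i))"
  \<comment> \<open>\<open>p\<close> and \<open>q\<close> span the eigenspaces of the rotation for \<open>cis \<theta>\<close> and \<open>cis (- \<theta>)\<close>, so it is
    \<open>K\<close> plus two rank-one terms, and \<open>A W - W B\<close> depends on \<open>\<theta>\<close> through four rank-one terms.\<close>
  define K where "K = ?c (mat 1 - outer_product a a - outer_product b b)"
  \<comment> \<open>The four coefficients are kept apart although they are evaluated only with s = t
    and u = v: the determinant is affine in each of them, but may be quadratic in a common
    value.\<close>
  define \<Phi> where "\<Phi> s t u v = det (?c A ** K - K ** ?c B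
      + outer_product (s *s ((1/2) *s (?c A *v p))) q + outer_product (t *s ((-1/2) *s p)) (q v* ?c B)
      + outer_product (u *s ((1/2) *s (?c A *v q))) p + outer_product (v *s ((-1/2) *s q)) (p v* ?c B))"
    for s t u v
  have W: "?c (plane_rotation a b \<theta>) = K + outer_product ((cis \<theta> / 2) *s p) q
      + outer_product ((inverse (cis \<theta>) / 2) *s q) p" for \<theta>
    by (simp add: plane_rotation_def K_def p_def q_def outer_product_def map_matrix_def vec_eq_iff
        complex_eq_iff mat_def cis_inverse)
       (simp add: field_simps)
  have main: "of_real (det (A - plane_rotation a b \<theta> ** B ** transpose (plane_rotation a b \<theta>)))
      = \<Phi> (cis \<theta>) (cis \<theta>) (inverse (cis \<theta>)) (inverse (cis \<theta>))" for \<theta>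
  proof -
    have "?c (A ** plane_rotation a b \<theta> - plane_rotation a b \<theta> ** B)
        = ?c A ** ?c (plane_rotation a b \<theta>) - ?c (plane_rotation a b \<theta>) ** ?c B"
      by (simp add: map_matrix_def vec_eq_iff matrix_matrix_mult_def)
    also have "\<dots> = ?c A ** K - K ** ?c B
      + outer_product (cis \<theta> *s ((1/2) *s (?c A *v p))) q
      + outer_product (cis \<theta> *s ((-1/2) *s p)) (q v* ?c B)
      + outer_product (inverse (cis \<theta>) *s ((1/2) *s (?c A *v q))) p
      + outer_product (inverse (cis \<theta>) *s ((-1/2) *s q)) (p v* ?c B)"
      unfolding W matrix_add_ldistrib matrix_add_rdistrib matrix_mult_outer_product
        outer_product_matrix_mult vector_scalar_commute
      by (simp add: outer_product_def vec_eq_iff field_simps)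
    finally show ?thesis
      unfolding det_conj_plane_rotation[OF assms] of_real_det \<Phi>_def by simp
  qed
  define w where "w = cis (2 * pi / 3)"
  have "\<exists>K. \<forall>z. z \<noteq> 0 \<longrightarrow>
    (\<Sum>j<3. \<Phi> (w ^ j * z) (w ^ j * z) (inverse (w ^ j * z)) (inverse (w ^ j * z))) = K"
  proof (rule cube_root_sum_multiaffine[where \<Phi> = \<Phi>])
    have w: "w = Complex (- 1/2) (sqrt 3 / 2)"
      by (simp add: w_def complex_eq_iff cos_120 sin_120)
    show "w\<^sup>2 + w + 1 = 0"
      unfolding w by (simp add: complex_eq_iff power2_eq_square)
  next
    fix s t u v
    note * = det_add_outer_product_affine
    \<comment> \<open>For each argument the other three rank-one terms join the base matrix, so that
      a single update remains.\<close>
    let ?M = "?c A ** K - K ** ?c B"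
    let ?o1 = "\<lambda>s. outer_product (s *s ((1/2) *s (?c A *v p))) q"
    let ?o2 = "\<lambda>t. outer_product (t *s ((-1/2) *s p)) (q v* ?c B)"
    let ?o3 = "\<lambda>u. outer_product (u *s ((1/2) *s (?c A *v q))) p"
    let ?o4 = "\<lambda>v. outer_product (v *s ((-1/2) *s q)) (p v* ?c B)"
    show "\<Phi> s t u v = (1 - s) * \<Phi> 0 t u v + s * \<Phi> 1 t u v"
      using *[of "?M + ?o2 t + ?o3 u + ?o4 v" s "(1/2) *s (?c A *v p)" q] unfolding \<Phi>_def by (simp only: add_ac)
    show "\<Phi> s t u v = (1 - t) * \<Phi> s 0 u v + t * \<Phi> s 1 u v"
      using *[of "?M + ?o1 s + ?o3 u + ?o4 v" t "(-1/2) *s p" "q v* ?c B"] unfolding \<Phi>_def by (simp only: add_ac)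
    show "\<Phi> s t u v = (1 - u) * \<Phi> s t 0 v + u * \<Phi> s t 1 v"
      using *[of "?M + ?o1 s + ?o2 t + ?o4 v" u "(1/2) *s (?c A *v q)" p] unfolding \<Phi>_def by (simp only: add_ac)
    show "\<Phi> s t u v = (1 - v) * \<Phi> s t u 0 + v * \<Phi> s t u 1"
      using *[of "?M + ?o1 s + ?o2 t + ?o3 u" v "(-1/2) *s q" "p v* ?c B"] unfolding \<Phi>_def by (simp only: add_ac)
  qed
  then obtain L where L: "\<And>z. z \<noteq> 0 \<Longrightarrow>
    (\<Sum>j<3. \<Phi> (w ^ j * z) (w ^ j * z) (inverse (w ^ j * z)) (inverse (w ^ j * z))) = L"
    by blast
  have cis: "w ^ j * cis \<theta> = cis (\<theta> + 2 * pi * real j / 3)" for j \<theta>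
    by (simp add: w_def Complex.DeMoivre cis_mult algebra_simps)
  have "complex_of_real (\<Sum>j<3. det (A - plane_rotation a b (\<theta> + 2 * pi * real j / 3) ** B
                        ** transpose (plane_rotation a b (\<theta> + 2 * pi * real j / 3)))) = L" for \<theta>
    unfolding of_real_sum main cis[symmetric] by (rule L) simp
  \<comment> \<open>The constant L is the same for every angle.\<close>
  from this[of \<theta>] this[of 0] show ?thesis
    by (metis (no_types, lifting) add_0 of_real_eq_iff sum.cong)
qed

section \<open>The symmetry group of the simplex\<close>

lemma orthogonal_group_mult: "P \<in> orthogonal_group \<Longrightarrow> Q \<in> orthogonal_group \<Longrightarrow> P ** Q \<in> orthogonal_group"
  by (simp add: orthogonal_group_def orthogonal_matrix_mul)

lemma orthogonal_group_transpose: "Q \<in> orthogonal_group \<Longrightarrow> transpose Q \<in> orthogonal_group"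
  by (simp add: orthogonal_group_def)

lemma orthogonal_group_mat_1: "mat 1 \<in> orthogonal_group"
  by (simp add: orthogonal_group_def orthogonal_matrix_id)

lemma orthogonal_group_transpose_mult:
  assumes "Q \<in> orthogonal_group"
  shows "transpose Q ** Q = mat 1" "Q ** transpose Q = mat 1"
  using assms by (auto simp: orthogonal_group_def orthogonal_matrix_def)

lemma orthogonal_group_inner:
  assumes "Q \<in> orthogonal_group"
  shows "(Q *v x) \<bullet> (Q *v y) = x \<bullet> y"
proof -
  have "(Q *v x) \<bullet> (Q *v y) = (transpose Q *v (Q *v x)) \<bullet> y"
    by (simp add: dot_lmul_matrix[symmetric] del: transpose_matrix_vector) simp
  then show ?thesis
    by (simp add: matrix_vector_mul_assoc orthogonal_group_transpose_mult[OF assms] del: transpose_matrix_vector)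
qed

lemma orthogonal_group_transpose_mult_vec:
  assumes "Q \<in> orthogonal_group"
  shows "transpose Q *v (Q *v x) = x"
  by (simp only: matrix_vector_mul_assoc orthogonal_group_transpose_mult[OF assms] matrix_vector_mul_lid)

lemma orthogonal_group_inj: "Q \<in> orthogonal_group \<Longrightarrow> inj ((*v) Q)"
  by (metis injI orthogonal_group_transpose_mult_vec)

section \<open>Continuity of matrix operations and compactness of the orthogonal group\<close>

lemma continuous_on_matrix_mult [continuous_intros]:
  fixes f :: "'a::topological_space \<Rightarrow> real^'n^'m" and g :: "'a \<Rightarrow> real^'k^'n"
  assumes "continuous_on S f" "continuous_on S g"
  shows "continuous_on S (\<lambda>x. f x ** g x)"
  unfolding matrix_matrix_mult_def by (intro continuous_intros assms)

lemma continuous_on_matrix_vector_mult: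
  fixes f :: "'a::topological_space \<Rightarrow> real^'n^'m"
  assumes "continuous_on S f"
  shows "continuous_on S (\<lambda>x. f x *v v)"
  unfolding matrix_vector_mult_def by (intro continuous_intros assms)

lemma continuous_on_transpose [continuous_intros]:
  fixes f :: "'a::topological_space \<Rightarrow> real^'n^'m"
  assumes "continuous_on S f"
  shows "continuous_on S (\<lambda>x. transpose (f x))"
  unfolding transpose_def by (intro continuous_intros assms)

lemma continuous_on_det [continuous_intros]:
  fixes f :: "'a::topological_space \<Rightarrow> real^'n^'n"
  assumes "continuous_on S f"
  shows "continuous_on S (\<lambda>x. det (f x))"
  unfolding det_def by (intro continuous_intros assms)

lemma closed_orthogonal_group: "closed (orthogonal_group :: (real^'n^'n) set)"
  unfolding orthogonal_group_def orthogonal_matrix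
  by (intro closed_Collect_eq continuous_intros)

lemma bounded_orthogonal_group: "bounded (orthogonal_group :: (real^'n^'n) set)"
proof (rule boundedI)
  fix Q :: "real^'n^'n"
  assume "Q \<in> orthogonal_group"
  then have "norm (Q $ i) = 1" for i
    by (simp add: orthogonal_group_def orthogonal_matrix_orthonormal_rows row_def)
  then show "norm Q \<le> real CARD('n)"
    unfolding norm_vec_def by (intro order_trans[OF L2_set_le_sum]) auto
qed

lemma compact_orthogonal_group: "compact (orthogonal_group :: (real^'n^'n) set)"
  by (simp add: compact_eq_bounded_closed closed_orthogonal_group bounded_orthogonal_group)

section \<open>Reflections in hyperplanes\<close>

definition reflection :: "real^'n \<Rightarrow> real^'n^'n" where
  "reflection w = mat 1 - (2 / (w \<bullet> w)) *\<^sub>R outer_product w w"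

lemma reflection_mult_vec: "reflection w *v x = x - (2 * (w \<bullet> x) / (w \<bullet> w)) *\<^sub>R w"
  by (simp add: reflection_def matrix_vector_mult_diff_rdistrib outer_product_mult_vec
      scaleR_matrix_vector_assoc[symmetric])

text \<open>The matrix is symmetric and its own inverse; at \<open>w = 0\<close> it is the
  identity.\<close>

lemma orthogonal_reflection: "reflection w \<in> orthogonal_group"
proof -
  have "transpose (reflection w) = reflection w"
    by (simp add: reflection_def transpose_def vec_eq_iff outer_product_def mat_def mult_ac)
  moreover have "reflection w *v (reflection w *v x) = x" for x
    unfolding reflection_mult_vec by (cases "w = 0") (simp_all add: inner_diff_right)
  ultimately show ?thesis
    by (simp add: orthogonal_group_def orthogonal_matrix matrix_eq flip: matrix_vector_mul_assoc)
qed

lemma reflection_conj: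
  assumes "Q \<in> orthogonal_group"
  shows "reflection u = transpose Q ** reflection (Q *v u) ** Q"
  unfolding matrix_eq
proof
  fix x
  have "transpose Q *v (Q *v y) = y" for y
    by (simp add: matrix_vector_mul_assoc orthogonal_group_transpose_mult[OF assms] del: transpose_matrix_vector)
  then show "reflection u *v x = (transpose Q ** reflection (Q *v u) ** Q) *v x"
    by (simp add: matrix_vector_mul_assoc[symmetric] reflection_mult_vec orthogonal_group_inner[OF assms]
        matrix_vector_mult_diff_distrib matrix_vector_mult_scaleR del: transpose_matrix_vector)
qed

lemma reflection_scaleR: "c \<noteq> 0 \<Longrightarrow> reflection (c *\<^sub>R w) = reflection w"
  by (simp add: matrix_eq reflection_mult_vec)

section \<open>Metric and linear facts about a regular simplex\<close>

lemma simplex_finite: "regular_simplex_vertices V \<Longrightarrow> finite V"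
  by (simp add: regular_simplex_vertices_def)

text \<open>In the sum of squared distances from v to all vertices the cross term vanishes, because
  the barycentre is 0; so \<open>v \<bullet> v\<close> is the same for every vertex. Inner products
  of distinct vertices then follow from the edge length s.\<close>

lemma simplex_inner:
  fixes V :: "(real^'n) set"
  assumes "regular_simplex_vertices V"
  obtains \<rho> s where "s > 0"
    and "\<And>u v. u \<in> V \<Longrightarrow> v \<in> V \<Longrightarrow> u \<bullet> v = (if u = v then \<rho> else \<rho> - s\<^sup>2 / 2)"
proof -
  have fin: "finite V" and card: "card V = CARD('n) + 1" and sum0: "(\<Sum>v\<in>V. v) = 0"
    and ex: "\<exists>s. \<forall>u\<in>V. \<forall>v\<in>V. u \<noteq> v \<longrightarrow> dist u v = s"
    using assms by (simp_all add: regular_simplex_vertices_def)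
  from ex obtain s where "\<forall>u\<in>V. \<forall>v\<in>V. u \<noteq> v \<longrightarrow> dist u v = s" ..
  then have dist: "\<And>u v. u \<in> V \<Longrightarrow> v \<in> V \<Longrightarrow> u \<noteq> v \<Longrightarrow> dist u v = s"
    by blast
  \<comment> \<open>The solution for \<open>v \<bullet> v\<close> of \<open>CARD('n) * s\<^sup>2 =
    card V * (v \<bullet> v) + (\<Sum>w\<in>V. w \<bullet> w)\<close>.\<close>
  define \<rho> where "\<rho> = (real CARD('n) * s\<^sup>2 - (\<Sum>w\<in>V. w \<bullet> w)) / card V"
  have "card V > 1"
    using card by simp
  then have "\<not> is_singleton V" "V \<noteq> {}"
    by (auto simp: is_singleton_altdef)
  then obtain u v where "u \<in> V" "v \<in> V" "u \<noteq> v"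
    by (metis is_singletonI')
  then have "s > 0"
    using dist by (metis dist_pos_lt)
  have norm: "v \<bullet> v = \<rho>" if "v \<in> V" for v
  proof -
    have "(\<Sum>w\<in>V. (v - w) \<bullet> (v - w)) = (\<Sum>w\<in>V - {v}. (v - w) \<bullet> (v - w))"
      using fin that by (simp add: sum.remove)
    also have "\<dots> = (\<Sum>w\<in>V - {v}. s\<^sup>2)"
    proof (rule sum.cong)
      fix w
      assume "w \<in> V - {v}"
      then have "norm (v - w) = s"
        using dist[of v w] that by (auto simp: dist_norm)
      then show "(v - w) \<bullet> (v - w) = s\<^sup>2"
        by (simp add: dot_square_norm)
    qed simp
    also have "\<dots> = real CARD('n) * s\<^sup>2"
      using that fin card by simp
    also have "(\<Sum>w\<in>V. (v - w) \<bullet> (v - w)) = (\<Sum>w\<in>V. v \<bullet> v + w \<bullet> w - 2 * (v \<bullet> w))"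
      by (intro sum.cong) (auto simp: inner_diff_left inner_diff_right inner_commute)
    also have "\<dots> = card V * (v \<bullet> v) + (\<Sum>w\<in>V. w \<bullet> w) - 2 * (v \<bullet> (\<Sum>w\<in>V. w))"
      by (simp add: sum.distrib sum_subtractf inner_sum_right sum_distrib_left)
    finally show ?thesis
      using sum0 card by (simp add: \<rho>_def field_simps)
  qed
  have "u \<bullet> v = (if u = v then \<rho> else \<rho> - s\<^sup>2 / 2)" if "u \<in> V" "v \<in> V" for u v
  proof (cases "u = v")
    case False
    have "s\<^sup>2 = (u - v) \<bullet> (u - v)"
      using dist[OF that False] by (simp add: dot_square_norm dist_norm)
    also have "\<dots> = \<rho> + \<rho> - 2 * (u \<bullet> v)"
      using norm[OF that(1)] norm[OF that(2)]
      by (simp add: inner_diff_left inner_diff_right inner_commute)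
    finally show ?thesis
      using False by (simp add: field_simps)
  qed (use norm that in simp)
  with \<open>s > 0\<close> show ?thesis
    by (rule that)
qed

text \<open>\<open>CARD('n) + 1\<close> affinely independent points have the whole space as affine
  hull, and this hull lies in the span.\<close>

lemma span_simplex:
  fixes V :: "(real^'n) set"
  assumes "regular_simplex_vertices V"
  shows "span V = UNIV"
proof -
  have "aff_dim V = DIM(real^'n)"
    using assms aff_dim_affine_independent[of V] by (simp add: regular_simplex_vertices_def)
  then show ?thesis
    using aff_dim_eq_full affine_hull_subset_span by blast
qed

text \<open>As the vertices sum to 0, the common value \<tau> is 0, so y is orthogonal to a spanning
  set.\<close>

lemma orthogonal_to_simplex:
  fixes V :: "(real^'n) set"
  assumes V: "regular_simplex_vertices V" and eq: "\<And>v. v \<in> V \<Longrightarrow> v \<bullet> y = \<tau>"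
  shows "y = 0"
proof -
  have "real (card V) * \<tau> = (\<Sum>v\<in>V. v) \<bullet> y"
    by (simp add: inner_sum_left eq)
  then have "\<tau> = 0"
    using V by (simp add: regular_simplex_vertices_def)
  then have "orthogonal y v" if "v \<in> V" for v
    using eq[OF that] by (simp add: orthogonal_def inner_commute)
  then have "orthogonal y y"
    using orthogonal_to_span[of y V y] span_simplex[OF V] by blast
  then show ?thesis
    by (simp add: orthogonal_def)
qed

section \<open>The symmetry group as a finite group\<close>

lemma simplex_groupI:
  assumes "finite V" "P \<in> orthogonal_group" "\<And>v. v \<in> V \<Longrightarrow> P *v v \<in> V"
  shows "P \<in> simplex_group V"
proof -
  have "inj_on ((*v) P) V"
    using orthogonal_group_inj[OF assms(2)] by (rule inj_on_subset) simp
  moreover have "(*v) P ` V \<subseteq> V"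
    using assms(3) by blast
  \<comment> \<open>An injective map of a finite set into itself is onto.\<close>
  ultimately show ?thesis
    using assms(1,2) by (simp add: simplex_group_def endo_inj_surj)
qed

lemma simplex_group_mult:
  assumes "P \<in> simplex_group V" "Q \<in> simplex_group V"
  shows "P ** Q \<in> simplex_group V"
proof -
  have "(*v) (P ** Q) ` V = (*v) P ` (*v) Q ` V"
    by (simp add: image_image matrix_vector_mul_assoc)
  then show ?thesis
    using assms by (simp add: simplex_group_def orthogonal_group_mult)
qed

lemma simplex_group_transpose:
  assumes "P \<in> simplex_group V"
  shows "transpose P \<in> simplex_group V"
proof -
  have P: "P \<in> orthogonal_group" "(*v) P ` V = V"
    using assms by (auto simp: simplex_group_def)
  have "(*v) (transpose P) ` V = (*v) (transpose P) ` (*v) P ` V"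
    using P by simp
  also have "\<dots> = V"
    by (simp add: image_image matrix_vector_mul_assoc orthogonal_group_transpose_mult[OF P(1)] del: transpose_matrix_vector)
  finally show ?thesis
    using P by (simp add: simplex_group_def orthogonal_group_transpose del: transpose_matrix_vector)
qed

lemma simplex_group_mat_1: "mat 1 \<in> simplex_group V"
  by (simp add: simplex_group_def orthogonal_group_mat_1)

text \<open>V spans, so an element is determined by its action on V; restriction embeds the group in
  the finite set of self-maps of V.\<close>

lemma finite_simplex_group:
  assumes "regular_simplex_vertices V"
  shows "finite (simplex_group V)"
proof (rule inj_on_finite)
  show "inj_on (\<lambda>P. restrict ((*v) P) V) (simplex_group V)"
  proof (rule inj_onI)
    fix P Q
    assume eq: "restrict ((*v) P) V = restrict ((*v) Q) V"
    have "P *v x = Q *v x" for x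
    proof (rule linear_eq_on_span[of _ _ V])
      show "x \<in> span V"
        using span_simplex[OF assms] by simp
      show "P *v v = Q *v v" if "v \<in> V" for v
        using eq that by (metis restrict_apply')
    qed auto
    then show "P = Q"
      by (simp add: matrix_eq)
  qed
  show "(\<lambda>P. restrict ((*v) P) V) ` simplex_group V \<subseteq> (V \<rightarrow>\<^sub>E V)"
    by (auto simp: simplex_group_def)
  show "finite (V \<rightarrow>\<^sub>E V)"
    using assms by (intro finite_PiE) (auto simp: regular_simplex_vertices_def)
qed

text \<open>Every other vertex is equidistant from u and v, hence on the mirror; the reflection acts
  on V as the transposition of u and v.\<close>

lemma reflection_in_simplex_group:
  assumes V: "regular_simplex_vertices V" and uv: "u \<in> V" "v \<in> V" "u \<noteq> v"
  shows "reflection (u - v) \<in> simplex_group V"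
proof (rule simplex_groupI[OF simplex_finite[OF V] orthogonal_reflection])
  fix t
  assume t: "t \<in> V"
  obtain \<rho> s where s: "s > 0"
    and inner: "\<And>u v. u \<in> V \<Longrightarrow> v \<in> V \<Longrightarrow> u \<bullet> v = (if u = v then \<rho> else \<rho> - s\<^sup>2 / 2)"
    using simplex_inner[OF V] by metis
  have "reflection (u - v) *v t = (if t = u then v else if t = v then u else t)"
    using s uv t by (auto simp: reflection_mult_vec inner inner_diff_left inner_diff_right)
  then show "reflection (u - v) *v t \<in> V"
    using uv t by simp
qed

section \<open>Rotations in the planes of vertex triangles\<close>

abbreviation vertex_rotation :: "real^'n \<Rightarrow> real^'n \<Rightarrow> real^'n \<Rightarrow> real \<Rightarrow> real^'n^'n" where
  "vertex_rotation u v t \<equiv> plane_rotation (sgn (u - v)) (sgn (2 *\<^sub>R t - u - v))"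

text \<open>The axes are an edge and the altitude over it: \<open>2 *\<^sub>R t - u - v\<close> is
  twice the vector from the midpoint of u and v to t, of length \<open>s * sqrt 3\<close>. The
  coefficients of either vector add up to 0, so \<rho> cancels from inner products with
  vertices.\<close>

lemma vertex_rotation_frame:
  assumes V: "regular_simplex_vertices V"
    and uvt: "u \<in> V" "v \<in> V" "t \<in> V" "u \<noteq> v" "u \<noteq> t" "v \<noteq> t"
  obtains s where "s > 0" "sgn (u - v) = (1 / s) *\<^sub>R (u - v)"
    "sgn (2 *\<^sub>R t - u - v) = (1 / (s * sqrt 3)) *\<^sub>R (2 *\<^sub>R t - u - v)"
    "orthonormal_pair (sgn (u - v)) (sgn (2 *\<^sub>R t - u - v))"
    "\<And>x. x \<in> V \<Longrightarrow> sgn (u - v) \<bullet> x = (if x = u then s / 2 else if x = v then - s / 2 else 0)"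
    "\<And>x. x \<in> V \<Longrightarrow> sgn (2 *\<^sub>R t - u - v) \<bullet> x =
       (if x = t then s / sqrt 3 else if x = u \<or> x = v then - s / (2 * sqrt 3) else 0)"
proof -
  obtain \<rho> s where s: "s > 0"
    and inner: "\<And>u v. u \<in> V \<Longrightarrow> v \<in> V \<Longrightarrow> u \<bullet> v = (if u = v then \<rho> else \<rho> - s\<^sup>2 / 2)"
    using simplex_inner[OF V] by metis
  have "(u - v) \<bullet> (u - v) = s\<^sup>2"
    using uvt by (simp add: inner_diff_left inner_diff_right inner)
  then have "norm (u - v) = s"
    using s by (simp add: norm_eq_sqrt_inner)
  then have a: "sgn (u - v) = (1 / s) *\<^sub>R (u - v)"
    by (simp add: sgn_div_norm inverse_eq_divide)
  have "(2 *\<^sub>R t - u - v) \<bullet> (2 *\<^sub>R t - u - v) = s\<^sup>2 * 3"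
    using uvt by (simp add: inner_diff_left inner_diff_right inner algebra_simps)
  then have "norm (2 *\<^sub>R t - u - v) = s * sqrt 3"
    using s by (simp add: norm_eq_sqrt_inner real_sqrt_mult)
  then have b: "sgn (2 *\<^sub>R t - u - v) = (1 / (s * sqrt 3)) *\<^sub>R (2 *\<^sub>R t - u - v)"
    by (simp add: sgn_div_norm inverse_eq_divide)
  have ax: "sgn (u - v) \<bullet> x = (if x = u then s / 2 else if x = v then - s / 2 else 0)" if "x \<in> V" for x
    unfolding a using uvt s that by (auto simp: inner_diff_left inner field_simps power2_eq_square)
  have bx: "sgn (2 *\<^sub>R t - u - v) \<bullet> x =
       (if x = t then s / sqrt 3 else if x = u \<or> x = v then - s / (2 * sqrt 3) else 0)" if "x \<in> V" for x
  proof -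
    have "(2 *\<^sub>R t - u - v) \<bullet> x = (if x = t then s\<^sup>2 else if x = u \<or> x = v then - s\<^sup>2 / 2 else 0)"
      using uvt that by (auto simp: inner_diff_left inner)
    then show ?thesis
      unfolding b inner_scaleR_left using s by (simp add: power2_eq_square)
  qed
  have "sgn (u - v) \<bullet> sgn (2 *\<^sub>R t - u - v) = 0"
    unfolding b using uvt by (simp add: inner_diff_right ax)
  moreover have "u - v \<noteq> 0" "2 *\<^sub>R t - u - v \<noteq> 0"
    using \<open>norm (u - v) = s\<close> \<open>norm (2 *\<^sub>R t - u - v) = s * sqrt 3\<close> s by auto
  ultimately have "orthonormal_pair (sgn (u - v)) (sgn (2 *\<^sub>R t - u - v))"
    by (simp add: orthonormal_pair_def dot_square_norm norm_sgn)
  from that[OF s a b this ax bx] show ?thesis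
    by blast
qed

text \<open>One third turn is the 3-cycle u to t to v to u and fixes the other vertices; its powers
  give the remaining turns.\<close>

lemma third_turn_in_simplex_group:
  assumes V: "regular_simplex_vertices V"
    and uvt: "u \<in> V" "v \<in> V" "t \<in> V" "u \<noteq> v" "u \<noteq> t" "v \<noteq> t"
  shows "vertex_rotation u v t (2 * pi * real j / 3) \<in> simplex_group V"
proof -
  let ?a = "sgn (u - v)" and ?b = "sgn (2 *\<^sub>R t - u - v)"
  obtain s where s: "s > 0"
    and a: "?a = (1 / s) *\<^sub>R (u - v)" and b: "?b = (1 / (s * sqrt 3)) *\<^sub>R (2 *\<^sub>R t - u - v)"
    and ab: "orthonormal_pair ?a ?b"
    and ax: "\<And>x. x \<in> V \<Longrightarrow> ?a \<bullet> x = (if x = u then s / 2 else if x = v then - s / 2 else 0)"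
    and bx: "\<And>x. x \<in> V \<Longrightarrow> ?b \<bullet> x =
       (if x = t then s / sqrt 3 else if x = u \<or> x = v then - s / (2 * sqrt 3) else 0)"
    by (rule vertex_rotation_frame[OF assms]) (rule that)
  have turn: "vertex_rotation u v t (2 * pi / 3) \<in> simplex_group V"
  proof (rule simplex_groupI[OF simplex_finite[OF V]])
    show "vertex_rotation u v t (2 * pi / 3) \<in> orthogonal_group"
      using orthogonal_plane_rotation[OF ab] by (simp add: orthogonal_group_def)
    fix x
    assume x: "x \<in> V"
    \<comment> \<open>c and d are the coefficients of the displacement of x along the unnormalised
      vectors \<open>u - v\<close> and \<open>2 *\<^sub>R t - u - v\<close>; in this scale they are
      rational.\<close>
    define c where "c = ((cos (2 * pi / 3) - 1) * (?a \<bullet> x) - sin (2 * pi / 3) * (?b \<bullet> x)) / s"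
    define d where "d = ((cos (2 * pi / 3) - 1) * (?b \<bullet> x) + sin (2 * pi / 3) * (?a \<bullet> x)) / (s * sqrt 3)"
    have c: "c = (if x = u \<or> x = t then - 1 / 2 else if x = v then 1 else 0)"
      using uvt s unfolding c_def ax[OF x] bx[OF x] cos_120 sin_120
      by (auto simp: field_simps)
    have d: "d = (if x = u then 1 / 2 else if x = t then - 1 / 2 else 0)"
      using uvt s unfolding d_def ax[OF x] bx[OF x] cos_120 sin_120
      by (auto simp: field_simps)
    have "vertex_rotation u v t (2 * pi / 3) *v x = x + (c * s) *\<^sub>R ?a + (d * (s * sqrt 3)) *\<^sub>R ?b"
      using s by (simp add: plane_rotation_mult_vec c_def d_def)
    also have "(c * s) *\<^sub>R ?a = c *\<^sub>R (u - v)"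
      using s by (subst a) simp
    also have "(d * (s * sqrt 3)) *\<^sub>R ?b = d *\<^sub>R (2 *\<^sub>R t - u - v)"
      using s by (subst b) simp
    also have "x + c *\<^sub>R (u - v) + d *\<^sub>R (2 *\<^sub>R t - u - v)
        = (if x = u then t else if x = t then v else if x = v then u else x)"
    proof -
      have u: "u + (- 1 / 2) *\<^sub>R (u - v) + (1 / 2) *\<^sub>R (2 *\<^sub>R t - u - v) = t"
        and t: "t + (- 1 / 2) *\<^sub>R (u - v) + (- 1 / 2) *\<^sub>R (2 *\<^sub>R t - u - v) = v"
        by (simp_all add: vec_eq_iff field_simps)
      show ?thesis
      proof (cases "x = u \<or> x = t")
        case True
        then show ?thesis
          using u t uvt unfolding c d by (elim disjE) simp_all
      qed (simp add: c d)
    qed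
    finally have "vertex_rotation u v t (2 * pi / 3) *v x
        = (if x = u then t else if x = t then v else if x = v then u else x)" .
    then show "vertex_rotation u v t (2 * pi / 3) *v x \<in> V"
      using uvt x by simp
  qed
  show ?thesis
  proof (induction j)
    case 0
    show ?case by (simp add: plane_rotation_0 simplex_group_mat_1)
  next
    case (Suc j)
    have eq: "2 * pi * real (Suc j) / 3 = 2 * pi / 3 + 2 * pi * real j / 3"
      by (simp add: field_simps)
    show ?case
      using simplex_group_mult[OF turn Suc.IH] unfolding eq plane_rotation_add[OF ab] by simp
  qed
qed

section \<open>Generating the orthogonal group\<close>

text \<open>The left side is a cosine wave that attains its amplitude
  \<open>sqrt (\<alpha>\<^sup>2 + \<beta>\<^sup>2)\<close>, and this exceeds \<alpha> unless \<beta>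
  is 0.\<close>

lemma phase_shift_maximum:
  fixes \<alpha> \<beta> :: real
  assumes "\<And>\<theta>. cos \<theta> * \<alpha> - sin \<theta> * \<beta> \<le> \<alpha>"
  shows "\<beta> = 0"
proof (rule ccontr)
  assume "\<beta> \<noteq> 0"
  define \<rho> where "\<rho> = sqrt (\<alpha>\<^sup>2 + \<beta>\<^sup>2)"
  have \<rho>2: "\<rho>\<^sup>2 = \<alpha>\<^sup>2 + \<beta>\<^sup>2" and "\<rho> > \<bar>\<alpha>\<bar>"
    using \<open>\<beta> \<noteq> 0\<close> by (auto simp: \<rho>_def intro!: real_less_rsqrt)
  then have "\<rho> > 0"
    by linarith
  \<comment> \<open>The angle of this point on the unit circle is the one where the wave
    peaks.\<close>
  have "(\<alpha> / \<rho>)\<^sup>2 + (- \<beta> / \<rho>)\<^sup>2 = (\<alpha>\<^sup>2 + \<beta>\<^sup>2) / \<rho>\<^sup>2"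
    by (simp add: power_divide add_divide_distrib)
  also have "\<dots> = 1"
    using \<open>\<rho> > 0\<close> by (simp add: \<rho>2[symmetric])
  finally obtain \<theta> where "\<alpha> / \<rho> = cos \<theta>" "- \<beta> / \<rho> = sin \<theta>"
    using sincos_total_2pi by metis
  then have "cos \<theta> * \<alpha> - sin \<theta> * \<beta> = \<rho>\<^sup>2 / \<rho>"
    unfolding \<rho>2 by (simp add: power2_eq_square add_divide_distrib flip: \<open>\<alpha> / \<rho> = cos \<theta>\<close> \<open>- \<beta> / \<rho> = sin \<theta>\<close>)
  also have "\<dots> = \<rho>"
    using \<open>\<rho> > 0\<close> by (simp add: power2_eq_square)
  finally show False
    using assms[of \<theta>] \<open>\<rho> > \<bar>\<alpha>\<bar>\<close> by linarith
qed

text \<open>H is later instantiated with the group of left translations that preserve the averaged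
  function.\<close>

context
  fixes V :: "(real^'n) set" and H :: "(real^'n^'n) set"
  assumes V: "regular_simplex_vertices V"
    and H_sub: "H \<subseteq> orthogonal_group" and H_closed: "closed H"
    and H_mult: "\<And>P Q. P \<in> H \<Longrightarrow> Q \<in> H \<Longrightarrow> P ** Q \<in> H"
    and H_transpose: "\<And>P. P \<in> H \<Longrightarrow> transpose P \<in> H"
    and H_simplex: "simplex_group V \<subseteq> H"
    and H_rotation: "\<And>u v t \<theta>. \<lbrakk>u \<in> V; v \<in> V; t \<in> V; u \<noteq> v; u \<noteq> t; v \<noteq> t\<rbrakk>
      \<Longrightarrow> vertex_rotation u v t \<theta> \<in> H"
begin

text \<open>Take \<open>h\<close> maximising the inner product of \<open>h x\<close> with \<open>u - v\<close>. Rotating in the plane of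
  \<open>u\<close>, \<open>v\<close> and a third vertex cannot increase it, so \<open>h x\<close> is orthogonal to the altitude of every
  triangle of vertices over the edge \<open>uv\<close>.\<close>

lemma moves_to_edge_direction:
  assumes uv: "u \<in> V" "v \<in> V" "u \<noteq> v"
  shows "\<exists>h\<in>H. \<exists>c. h *v x = c *\<^sub>R (u - v)"
proof -
  let ?w = "u - v"
  have "compact H"
    using H_closed H_sub bounded_orthogonal_group bounded_subset compact_eq_bounded_closed by blast
  moreover have "H \<noteq> {}"
    using H_simplex simplex_group_mat_1 by blast
  moreover have "continuous_on H (\<lambda>h. (h *v x) \<bullet> ?w)"
    by (intro continuous_intros continuous_on_matrix_vector_mult)
  ultimately obtain h where h: "h \<in> H" and max: "\<And>k. k \<in> H \<Longrightarrow> (k *v x) \<bullet> ?w \<le> (h *v x) \<bullet> ?w"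
    using continuous_attains_sup[of H "\<lambda>h. (h *v x) \<bullet> ?w"] by blast
  define y where "y = h *v x"
  have altitude: "(2 *\<^sub>R t - u - v) \<bullet> y = 0 \<and> (2 *\<^sub>R t - u - v) \<bullet> ?w = 0"
    if t: "t \<in> V" "u \<noteq> t" "v \<noteq> t" for t
  proof -
    let ?a = "sgn (u - v)" and ?b = "sgn (2 *\<^sub>R t - u - v)"
    obtain s where s: "s > 0" and a: "?a = (1 / s) *\<^sub>R (u - v)"
      and b: "?b = (1 / (s * sqrt 3)) *\<^sub>R (2 *\<^sub>R t - u - v)" and ab: "orthonormal_pair ?a ?b"
      by (rule vertex_rotation_frame[OF V uv(1,2) t(1) uv(3) t(2,3)]) (rule that)
    \<comment> \<open>Maximality of h is tested against \<open>?R ** h\<close> and brought to the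
      form of \<open>phase_shift_maximum\<close>.\<close>
    have "cos \<theta> * (?a \<bullet> y) - sin \<theta> * (?b \<bullet> y) \<le> ?a \<bullet> y" for \<theta>
    proof -
      let ?R = "vertex_rotation u v t \<theta>"
      have "?R ** h \<in> H"
        using H_rotation uv t h H_mult by blast
      then have "(?R *v y) \<bullet> ?w \<le> y \<bullet> ?w"
        using max by (simp add: y_def matrix_vector_mul_assoc)
      then have "(1 / s) * ((?R *v y) \<bullet> ?w) \<le> (1 / s) * (y \<bullet> ?w)"
        using s by (intro mult_left_mono) auto
      then have "?a \<bullet> (?R *v y) \<le> ?a \<bullet> y"
        unfolding a by (simp add: inner_commute)
      also have "?a \<bullet> (?R *v y) = cos \<theta> * (?a \<bullet> y) - sin \<theta> * (?b \<bullet> y)"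
        using ab by (simp add: plane_rotation_mult_vec orthonormal_pair_def inner_add_right algebra_simps)
      finally show ?thesis .
    qed
    then have "?b \<bullet> y = 0"
      by (rule phase_shift_maximum)
    moreover have "?a \<bullet> ?b = 0"
      using ab by (simp add: orthonormal_pair_def)
    ultimately show ?thesis
      using s unfolding a b by (simp add: inner_commute)
  qed
  define c where "c = (?w \<bullet> y) / (?w \<bullet> ?w)"
  \<comment> \<open>The component of y orthogonal to the edge. All vertices will have the same inner
    product with it, which forces it to be 0.\<close>
  define z where "z = y - c *\<^sub>R ?w"
  have "?w \<bullet> z = 0"
    using uv by (simp add: z_def c_def inner_diff_right[of ?w y])
  have "t \<bullet> z = u \<bullet> z" if "t \<in> V" for t
  proof -
    \<comment> \<open>In dimension 1 there are only the vertices u and v, and the third case is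
      vacuous.\<close>
    consider "t = u" | "t = v" | "u \<noteq> t" "v \<noteq> t"
      by blast
    then show ?thesis
    proof cases
      case 3
      have "(2 *\<^sub>R t - u - v) \<bullet> z = 0"
        using altitude[OF that 3] unfolding z_def inner_diff_right inner_scaleR_right by simp
      then show ?thesis
        using \<open>?w \<bullet> z = 0\<close> by (simp add: inner_diff_left)
    qed (use \<open>?w \<bullet> z = 0\<close> in \<open>simp_all add: inner_diff_left\<close>)
  qed
  then have "z = 0"
    by (rule orthogonal_to_simplex[OF V])
  then show ?thesis
    using h unfolding z_def y_def by force
qed

text \<open>An element of H moves x onto the line of an edge direction; the reflection along that
  edge lies in the simplex group and is conjugated back.\<close>

lemma reflection_in_group: "reflection x \<in> H"
proof (cases "x = 0")
  case True
  then have "reflection x = mat 1"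
    by (simp add: matrix_eq reflection_mult_vec)
  then show ?thesis
    using H_simplex simplex_group_mat_1 by auto
next
  case False
  have "\<not> is_singleton V" "V \<noteq> {}"
    using V by (auto simp: is_singleton_altdef regular_simplex_vertices_def)
  then obtain u v where uv: "u \<in> V" "v \<in> V" "u \<noteq> v"
    by (metis is_singletonI')
  obtain h c where h: "h \<in> H" and c: "h *v x = c *\<^sub>R (u - v)"
    using moves_to_edge_direction[OF uv] by blast
  have "c \<noteq> 0"
  proof
    assume "c = 0"
    then have "x \<bullet> x = 0"
      using orthogonal_group_inner[of h x x] h H_sub c by auto
    then show False
      using False by simp
  qed
  then have "reflection x = transpose h ** reflection (u - v) ** h"
    using reflection_conj[of h x] h H_sub c by (auto simp: reflection_scaleR)
  then show ?thesis
    using h H_mult H_transpose H_simplex reflection_in_simplex_group[OF V uv] by auto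
qed

text \<open>Axes are put in place one at a time, as in the factorisation of an orthogonal matrix
  into reflections: reflecting along \<open>?e - M *v ?e\<close> brings \<open>M *v ?e\<close> to
  \<open>?e\<close> and keeps the axes fixed before.\<close>

lemma fixes_axes:
  assumes Q: "Q \<in> orthogonal_group" and "finite S"
  shows "\<exists>h\<in>H. \<forall>i\<in>S. (h ** Q) *v axis i 1 = axis i 1"
  using \<open>finite S\<close>
proof (induction S)
  case empty
  then show ?case
    using H_simplex simplex_group_mat_1 by blast
next
  case (insert k S)
  then obtain h where h: "h \<in> H" and axes: "\<And>i. i \<in> S \<Longrightarrow> (h ** Q) *v axis i 1 = axis i 1"
    by blast
  let ?e = "axis k 1 :: real^'n"
  define M where "M = h ** Q"
  define w where "w = ?e - M *v ?e"
  have M: "M \<in> orthogonal_group"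
    using h H_sub Q by (auto simp: M_def intro: orthogonal_group_mult)
  have "reflection w *v (M *v axis i 1) = axis i 1" if "i \<in> insert k S" for i
  proof (cases "i = k")
    case True
    \<comment> \<open>Both \<open>?e\<close> and \<open>M *v ?e\<close> have the same length, so the
      mirror lies midway between them.\<close>
    have "w \<bullet> w = - 2 * (w \<bullet> (M *v ?e))"
      using orthogonal_group_inner[OF M, of ?e ?e]
      by (simp add: w_def inner_diff_left inner_diff_right inner_commute)
    then have "w = 0 \<or> 2 * (w \<bullet> (M *v ?e)) / (w \<bullet> w) = - 1"
      by (auto simp: field_simps)
    then show ?thesis
      using True by (auto simp: reflection_mult_vec w_def)
  next
    case False
    then have i: "M *v axis i 1 = axis i 1"
      using that axes by (auto simp: M_def)
    \<comment> \<open>M preserves inner products, so w is orthogonal to an axis that M already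
      fixes.\<close>
    have "w \<bullet> axis i 1 = ?e \<bullet> axis i 1 - (M *v ?e) \<bullet> (M *v axis i 1)"
      by (simp add: w_def inner_diff_left i)
    also have "\<dots> = 0"
      by (simp add: orthogonal_group_inner[OF M])
    finally show ?thesis
      by (simp add: reflection_mult_vec i)
  qed
  then have "\<forall>i\<in>insert k S. (reflection w ** h ** Q) *v axis i 1 = axis i 1"
    by (simp only: M_def matrix_vector_mul_assoc matrix_mul_assoc) blast
  moreover have "reflection w ** h \<in> H"
    using h H_mult reflection_in_group by blast
  ultimately show ?case
    by blast
qed

lemma group_eq_orthogonal_group: "H = orthogonal_group"
proof (intro equalityI H_sub subsetI)
  fix Q :: "real^'n^'n"
  assume Q: "Q \<in> orthogonal_group"
  then obtain h where h: "h \<in> H" and axes: "\<And>i. (h ** Q) *v axis i 1 = axis i 1"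
    using fixes_axes[OF Q, of UNIV] by auto
  have "h ** Q = mat 1"
  proof -
    have "column i (h ** Q) = column i (mat 1)" for i
      using axes[of i] by (metis matrix_vector_mult_basis matrix_vector_mul_lid)
    then show ?thesis
      by (simp add: vec_eq_iff column_def)
  qed
  then have "Q = transpose h"
    using orthogonal_group_transpose_mult(1)[of h] h H_sub
    by (metis matrix_mul_assoc matrix_mul_lid matrix_mul_rid subsetD)
  then show "Q \<in> H"
    using H_transpose[OF h] by simp
qed

end

section \<open>Averaging over the simplex group\<close>

text \<open>Besides continuity, this is what the averaging argument asks of f. The factors P and Q
  on both sides let it apply to translates of f and pass to functions of one block.\<close>

definition third_turn_invariant :: "(real^'n^'n \<Rightarrow> real) \<Rightarrow> bool" where
  "third_turn_invariant f \<longleftrightarrow> (\<forall>P\<in>orthogonal_group. \<forall>Q\<in>orthogonal_group. \<forall>a b \<theta>. orthonormal_pair a b \<longrightarrow>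
     (\<Sum>j<3. f (P ** plane_rotation a b (\<theta> + 2 * pi * real j / 3) ** Q))
     = (\<Sum>j<(3::nat). f (P ** plane_rotation a b (2 * pi * real j / 3) ** Q)))"

lemma simplex_sum_left_mult:
  assumes "T \<in> simplex_group V"
  shows "(\<Sum>P\<in>simplex_group V. f (P ** T)) = (\<Sum>P\<in>simplex_group V. f P)"
proof (rule sum.reindex_bij_witness[where j = "\<lambda>P. P ** T" and i = "\<lambda>P. P ** transpose T"])
  have T: "transpose T ** T = mat 1" "T ** transpose T = mat 1"
    using assms orthogonal_group_transpose_mult[of T] by (auto simp: simplex_group_def)
  show "P ** T ** transpose T = P" "P ** transpose T ** T = P" for P
    by (simp_all add: matrix_mul_assoc[symmetric] T)
qed (use assms in \<open>auto intro: simplex_group_mult simplex_group_transpose\<close>)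

text \<open>The group H of left translations preserving g, the sum as a function of Q, meets the
  hypotheses of \<open>group_eq_orthogonal_group\<close>, so it can carry \<open>mat 1\<close> to
  any Q.\<close>

lemma simplex_sum_constant:
  fixes f :: "real^'n^'n \<Rightarrow> real"
  assumes V: "regular_simplex_vertices V"
    and cont: "continuous_on UNIV f" and inv: "third_turn_invariant f"
    and Q: "Q \<in> orthogonal_group"
  shows "(\<Sum>P\<in>simplex_group V. f (P ** Q)) = (\<Sum>P\<in>simplex_group V. f P)"
proof -
  define g where "g Q = (\<Sum>P\<in>simplex_group V. f (P ** Q))" for Q
  define H where "H = {h \<in> orthogonal_group. \<forall>Q\<in>orthogonal_group. g (h ** Q) = g Q}"
  have cont_g: "continuous_on S (\<lambda>h. g (h ** Q))" for S Q
    unfolding g_def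
    by (intro continuous_intros continuous_on_compose2[OF cont]) auto
  have simplex: "g (T ** Q) = g Q" if "T \<in> simplex_group V" for T Q
    using simplex_sum_left_mult[OF that, of "\<lambda>P. f (P ** Q)"] by (simp add: g_def matrix_mul_assoc)
  have "H = orthogonal_group"
  proof (rule group_eq_orthogonal_group[OF V])
    show "H \<subseteq> orthogonal_group"
      by (auto simp: H_def)
    have "H = orthogonal_group \<inter> (\<Inter>Q\<in>orthogonal_group. {h. g (h ** Q) = g Q})"
      by (auto simp: H_def)
    also have "closed \<dots>"
      by (intro closed_Int closed_orthogonal_group closed_INT ballI closed_Collect_eq cont_g
          continuous_intros)
    finally show "closed H" .
    show "P ** Q \<in> H" if "P \<in> H" "Q \<in> H" for P Q
      using that by (auto simp: H_def orthogonal_group_mult matrix_mul_assoc[symmetric])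
    show "transpose P \<in> H" if "P \<in> H" for P
    proof -
      have P: "P \<in> orthogonal_group" "\<And>Q. Q \<in> orthogonal_group \<Longrightarrow> g (P ** Q) = g Q"
        using that by (auto simp: H_def)
      have "g (transpose P ** Q) = g Q" if "Q \<in> orthogonal_group" for Q
        using P(2)[of "transpose P ** Q"] that P(1)
        by (simp add: orthogonal_group_mult orthogonal_group_transpose matrix_mul_assoc
            orthogonal_group_transpose_mult)
      then show ?thesis
        using P(1) by (simp add: H_def orthogonal_group_transpose)
    qed
    show "simplex_group V \<subseteq> H"
      using simplex by (auto simp: H_def simplex_group_def)
  next
    fix u v t \<theta>
    assume uvt: "u \<in> V" "v \<in> V" "t \<in> V" "u \<noteq> v" "u \<noteq> t" "v \<noteq> t"
    let ?R = "vertex_rotation u v t"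
    have ab: "orthonormal_pair (sgn (u - v)) (sgn (2 *\<^sub>R t - u - v))"
      by (rule vertex_rotation_frame[OF V uvt])
    have "g (?R \<theta> ** Q) = g Q" if Q: "Q \<in> orthogonal_group" for Q
    proof -
      \<comment> \<open>An extra third turn lies in the simplex group and leaves g unchanged, so
        each of the two sums below has three equal terms.\<close>
      have turn: "g (?R (\<theta> + 2 * pi * real j / 3) ** Q) = g (?R \<theta> ** Q)" for \<theta> j
        using simplex[OF third_turn_in_simplex_group[OF V uvt, of j], of "?R \<theta> ** Q"]
        by (simp add: matrix_mul_assoc plane_rotation_add[OF ab] add.commute)
      have "(\<Sum>j<3. g (?R (\<theta> + 2 * pi * real j / 3) ** Q)) = (\<Sum>j<(3::nat). g (?R (2 * pi * real j / 3) ** Q))"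
        unfolding g_def matrix_mul_assoc
        by (subst (1 2) sum.swap)
           (use inv ab Q in \<open>auto simp: third_turn_invariant_def simplex_group_def intro!: sum.cong\<close>)
      then show ?thesis
        using turn[of \<theta>] turn[of 0] by (simp add: plane_rotation_0)
    qed
    then show "?R \<theta> \<in> H"
      using orthogonal_plane_rotation[OF ab] by (simp add: H_def orthogonal_group_def)
  qed
  then have "g (Q ** mat 1) = g (mat 1)"
    using Q orthogonal_group_mat_1 unfolding H_def by blast
  then show ?thesis
    by (simp add: g_def)
qed

section \<open>Averages and Haar integrals\<close>

lemma measurable_id_haar:
  assumes "haar_orthogonal \<mu>"
  shows "(\<lambda>Q. Q) \<in> borel_measurable \<mu>"
  using assms measurable_restrict_space1[of "\<lambda>Q. Q" borel borel]
  by (simp add: haar_orthogonal_def cong: measurable_cong_sets)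

text \<open>The sum over P of \<open>f (P ** Q)\<close> is constant in Q on the orthogonal group, so
  it equals its integral; by left invariance of \<mu> each summand integrates to the integral of
  f.\<close>

lemma simplex_average_eq_integral:
  fixes f :: "real^'n^'n \<Rightarrow> real"
  assumes V: "regular_simplex_vertices V" and haar: "haar_orthogonal \<mu>"
    and cont: "continuous_on UNIV f" and inv: "third_turn_invariant f"
  shows "(\<Sum>P\<in>simplex_group V. f P) / card (simplex_group V) = (\<integral>Q. f Q \<partial>\<mu>)"
proof -
  interpret prob_space \<mu>
    using haar by (simp add: haar_orthogonal_def)
  have space: "space \<mu> = orthogonal_group"
    and sets: "sets \<mu> = sets (restrict_space borel orthogonal_group)"
    and invariant: "\<And>G. G \<in> orthogonal_group \<Longrightarrow> distr \<mu> \<mu> (\<lambda>Q. G ** Q) = \<mu>"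
    using haar by (auto simp: haar_orthogonal_def)
  have meas: "f \<in> borel_measurable \<mu>"
    using measurable_compose[OF measurable_id_haar[OF haar] borel_measurable_continuous_onI[OF cont]] .
  \<comment> \<open>A bound on the compact group gives integrability against a probability
    measure.\<close>
  have "bounded (f ` orthogonal_group)"
    using cont compact_orthogonal_group
    by (intro compact_imp_bounded compact_continuous_image) (auto intro: continuous_on_subset)
  then obtain B where B: "\<And>Q. Q \<in> orthogonal_group \<Longrightarrow> \<bar>f Q\<bar> \<le> B"
    by (auto simp: bounded_iff)
  have translate: "integrable \<mu> (\<lambda>Q. f (P ** Q)) \<and> (\<integral>Q. f (P ** Q) \<partial>\<mu>) = (\<integral>Q. f Q \<partial>\<mu>)"
    if P: "P \<in> orthogonal_group" for P
  proof -
    have "(\<lambda>Q. P ** Q) \<in> measurable \<mu> (restrict_space borel orthogonal_group)"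
    proof (rule measurable_restrict_space2)
      show "(\<lambda>Q. P ** Q) \<in> space \<mu> \<rightarrow> orthogonal_group"
        using P by (auto simp: space orthogonal_group_mult)
      have "continuous_on UNIV (\<lambda>Q. P ** Q)"
        by (intro continuous_intros)
      then show "(\<lambda>Q. P ** Q) \<in> borel_measurable \<mu>"
        using measurable_compose[OF measurable_id_haar[OF haar]] borel_measurable_continuous_onI by blast
    qed
    then have mult: "(\<lambda>Q. P ** Q) \<in> measurable \<mu> \<mu>"
      using sets by (simp cong: measurable_cong_sets)
    then have "(\<lambda>Q. f (P ** Q)) \<in> borel_measurable \<mu>"
      using meas by (rule measurable_compose)
    moreover have "AE Q in \<mu>. norm (f (P ** Q)) \<le> B"
      using P B by (intro AE_I2) (simp add: space orthogonal_group_mult)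
    ultimately have "integrable \<mu> (\<lambda>Q. f (P ** Q))"
      by (intro integrable_const_bound)
    then show ?thesis
      using integral_distr[OF mult meas] invariant[OF P] by simp
  qed
  have G: "P \<in> orthogonal_group" if "P \<in> simplex_group V" for P
    using that by (simp add: simplex_group_def)
  have "(\<Sum>P\<in>simplex_group V. f P) = (\<integral>Q. (\<Sum>P\<in>simplex_group V. f P) \<partial>\<mu>)"
    by (simp add: prob_space)
  also have "\<dots> = (\<integral>Q. (\<Sum>P\<in>simplex_group V. f (P ** Q)) \<partial>\<mu>)"
    using simplex_sum_constant[OF V cont inv] by (intro Bochner_Integration.integral_cong) (auto simp: space)
  also have "\<dots> = (\<Sum>P\<in>simplex_group V. (\<integral>Q. f (P ** Q) \<partial>\<mu>))"
    using translate G by (intro Bochner_Integration.integral_sum) blast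
  also have "\<dots> = card (simplex_group V) * (\<integral>Q. f Q \<partial>\<mu>)"
    using translate G by simp
  finally show ?thesis
    using finite_simplex_group[OF V] simplex_group_mat_1[of V] by (auto simp: field_simps)
qed

text \<open>Conjugating by P keeps the determinant and absorbs P into A and Q into D, which reduces
  the claim to \<open>plane_rotation_third_turn_sum\<close>.\<close>

lemma third_turn_invariant_det:
  fixes A D :: "real^'n^'n"
  shows "third_turn_invariant (\<lambda>M. det (A - M ** D ** transpose M))"
  unfolding third_turn_invariant_def
proof (intro ballI allI impI)
  fix P Q :: "real^'n^'n" and a b :: "real^'n" and \<theta> :: real
  assume P: "P \<in> orthogonal_group" and Q: "Q \<in> orthogonal_group" and ab: "orthonormal_pair a b"
  have "det (A - (P ** W ** Q) ** D ** transpose (P ** W ** Q))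
      = det (transpose P ** A ** P - W ** (Q ** D ** transpose Q) ** transpose W)" for W
  proof -
    let ?X = "A - (P ** W ** Q) ** D ** transpose (P ** W ** Q)"
    have PP: "transpose P ** P = mat 1"
      using orthogonal_group_transpose_mult(1)[OF P] .
    have "transpose P ** ?X ** P
        = transpose P ** A ** P - (transpose P ** P) ** W ** Q ** D ** transpose Q ** transpose W ** (transpose P ** P)"
      by (simp add: matrix_diff_ldistrib matrix_diff_rdistrib matrix_transpose_mul matrix_mul_assoc)
    also have "\<dots> = transpose P ** A ** P - W ** (Q ** D ** transpose Q) ** transpose W"
      by (simp add: PP matrix_mul_assoc)
    finally have "det (transpose P) * det ?X * det P
        = det (transpose P ** A ** P - W ** (Q ** D ** transpose Q) ** transpose W)"
      by (simp only: det_mul[symmetric])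
    moreover have "det (transpose P) * det P = 1"
      by (simp only: det_mul[symmetric] PP det_I)
    ultimately show ?thesis
      by (metis (no_types) mult.commute mult.assoc mult_1)
  qed
  then show "(\<Sum>j<3. det (A - P ** plane_rotation a b (\<theta> + 2 * pi * real j / 3) ** Q ** D **
        transpose (P ** plane_rotation a b (\<theta> + 2 * pi * real j / 3) ** Q)))
    = (\<Sum>j<(3::nat). det (A - P ** plane_rotation a b (2 * pi * real j / 3) ** Q ** D **
        transpose (P ** plane_rotation a b (2 * pi * real j / 3) ** Q)))"
    by (simp only: plane_rotation_third_turn_sum[OF ab])
qed

section \<open>Block diagonal matrices\<close>

lemma sum_UNIV_Plus:
  fixes f :: "'a::finite + 'b::finite \<Rightarrow> 'c::comm_monoid_add"
  shows "(\<Sum>i\<in>UNIV. f i) = (\<Sum>i\<in>UNIV. f (Inl i)) + (\<Sum>i\<in>UNIV. f (Inr i))"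
  by (simp only: UNIV_Plus_UNIV[symmetric] sum.Plus[OF finite_class.finite_UNIV finite_class.finite_UNIV] o_def)

lemma forall_sum_iff: "(\<forall>i::'a + 'b. P i) \<longleftrightarrow> (\<forall>i. P (Inl i)) \<and> (\<forall>i. P (Inr i))"
  by (metis sum.exhaust)

lemma block_diag_mult:
  fixes X X' :: "'a::semiring_1^'n^'n" and Y Y' :: "'a^'m^'m"
  shows "(X \<oplus>\<^sub>d Y) ** (X' \<oplus>\<^sub>d Y') = (X ** X') \<oplus>\<^sub>d (Y ** Y')"
  by (simp add: block_diag_def matrix_matrix_mult_def vec_eq_iff forall_sum_iff sum_UNIV_Plus)

lemma transpose_block_diag: "transpose (X \<oplus>\<^sub>d Y) = transpose X \<oplus>\<^sub>d transpose Y"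
  by (simp add: block_diag_def transpose_def vec_eq_iff forall_sum_iff)

lemma block_diag_mat_1: "mat 1 \<oplus>\<^sub>d mat 1 = mat 1"
  by (simp add: block_diag_def mat_def vec_eq_iff forall_sum_iff)

lemma block_diag_orthogonal:
  assumes "X \<in> orthogonal_group" "Y \<in> orthogonal_group"
  shows "X \<oplus>\<^sub>d Y \<in> orthogonal_group"
  using assms by (simp add: orthogonal_group_def orthogonal_matrix transpose_block_diag block_diag_mult
      block_diag_mat_1)

text \<open>Padding a and b with zeros yields a plane inside the first block, whose rotations are
  the identity on the second.\<close>

lemma plane_rotation_block_left:
  fixes a b :: "real^'n::finite"
  assumes "orthonormal_pair a b"
  obtains a' b' :: "real^('n::finite + 'm::finite)" where "orthonormal_pair a' b'"
    "\<And>\<theta>. plane_rotation a b \<theta> \<oplus>\<^sub>d mat 1 = plane_rotation a' b' \<theta>"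
proof
  let ?e = "\<lambda>v. (\<chi> i. case i of Inl k \<Rightarrow> v $ k | Inr _ \<Rightarrow> 0) :: real^('n + 'm::finite)"
  show "orthonormal_pair (?e a) (?e b)"
    using assms by (simp add: orthonormal_pair_def inner_vec_def sum_UNIV_Plus)
  show "plane_rotation a b \<theta> \<oplus>\<^sub>d mat 1 = plane_rotation (?e a) (?e b) \<theta>" for \<theta>
    by (simp add: plane_rotation_def block_diag_def outer_product_def mat_def vec_eq_iff forall_sum_iff)
qed

lemma plane_rotation_block_right:
  fixes a b :: "real^'m"
  assumes "orthonormal_pair a b"
  obtains a' b' :: "real^('n::finite + 'm::finite)" where "orthonormal_pair a' b'"
    "\<And>\<theta>. mat 1 \<oplus>\<^sub>d plane_rotation a b \<theta> = plane_rotation a' b' \<theta>"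
proof
  let ?e = "\<lambda>v. (\<chi> i. case i of Inl _ \<Rightarrow> 0 | Inr k \<Rightarrow> v $ k) :: real^('n + 'm::finite)"
  show "orthonormal_pair (?e a) (?e b)"
    using assms by (simp add: orthonormal_pair_def inner_vec_def sum_UNIV_Plus)
  show "mat 1 \<oplus>\<^sub>d plane_rotation a b \<theta> = plane_rotation (?e a) (?e b) \<theta>" for \<theta>
    by (simp add: plane_rotation_def block_diag_def outer_product_def mat_def vec_eq_iff forall_sum_iff)
qed

text \<open>The fixed block goes into the left factor:
  \<open>(P ** W ** Q) \<oplus>\<^sub>d R\<close> equals \<open>(P \<oplus>\<^sub>d R) ** (W
  \<oplus>\<^sub>d mat 1) ** (Q \<oplus>\<^sub>d mat 1)\<close>.\<close>

lemma third_turn_invariant_block_left: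
  fixes f :: "real^('n::finite + 'm::finite)^('n + 'm) \<Rightarrow> real"
  assumes f: "third_turn_invariant f" and R: "R \<in> orthogonal_group"
  shows "third_turn_invariant (\<lambda>Q. f (Q \<oplus>\<^sub>d R))"
  unfolding third_turn_invariant_def
proof (intro ballI allI impI)
  fix P Q :: "real^'n^'n" and a b :: "real^'n" and \<theta> :: real
  assume PQ: "P \<in> orthogonal_group" "Q \<in> orthogonal_group" and ab: "orthonormal_pair a b"
  obtain a' b' :: "real^('n + 'm::finite)" where ab': "orthonormal_pair a' b'"
    and rot: "\<And>\<theta>. plane_rotation a b \<theta> \<oplus>\<^sub>d mat 1 = plane_rotation a' b' \<theta>"
    using plane_rotation_block_left[OF ab] by blast
  have "(P ** plane_rotation a b \<theta> ** Q) \<oplus>\<^sub>d R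
      = (P \<oplus>\<^sub>d R) ** plane_rotation a' b' \<theta> ** (Q \<oplus>\<^sub>d mat 1)" for \<theta>
    by (simp add: rot[symmetric] block_diag_mult)
  then show "(\<Sum>j<3. f ((P ** plane_rotation a b (\<theta> + 2 * pi * real j / 3) ** Q) \<oplus>\<^sub>d R))
    = (\<Sum>j<(3::nat). f ((P ** plane_rotation a b (2 * pi * real j / 3) ** Q) \<oplus>\<^sub>d R))"
    using f PQ R ab' unfolding third_turn_invariant_def
    by (simp add: block_diag_orthogonal orthogonal_group_mat_1)
qed

lemma third_turn_invariant_block_right:
  fixes f :: "real^('n::finite + 'm::finite)^('n + 'm) \<Rightarrow> real"
  assumes f: "third_turn_invariant f" and R: "R \<in> orthogonal_group"
  shows "third_turn_invariant (\<lambda>Q. f (R \<oplus>\<^sub>d Q))"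
  unfolding third_turn_invariant_def
proof (intro ballI allI impI)
  fix P Q :: "real^'m^'m" and a b :: "real^'m" and \<theta> :: real
  assume PQ: "P \<in> orthogonal_group" "Q \<in> orthogonal_group" and ab: "orthonormal_pair a b"
  obtain a' b' :: "real^('n + 'm::finite)" where ab': "orthonormal_pair a' b'"
    and rot: "\<And>\<theta>. mat 1 \<oplus>\<^sub>d plane_rotation a b \<theta> = plane_rotation a' b' \<theta>"
    using plane_rotation_block_right[OF ab] by blast
  have "R \<oplus>\<^sub>d (P ** plane_rotation a b \<theta> ** Q)
      = (R \<oplus>\<^sub>d P) ** plane_rotation a' b' \<theta> ** (mat 1 \<oplus>\<^sub>d Q)" for \<theta>
    by (simp add: rot[symmetric] block_diag_mult)
  then show "(\<Sum>j<3. f (R \<oplus>\<^sub>d (P ** plane_rotation a b (\<theta> + 2 * pi * real j / 3) ** Q)))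
    = (\<Sum>j<(3::nat). f (R \<oplus>\<^sub>d (P ** plane_rotation a b (2 * pi * real j / 3) ** Q)))"
    using f PQ R ab' unfolding third_turn_invariant_def
    by (simp add: block_diag_orthogonal orthogonal_group_mat_1)
qed

lemma continuous_on_block_diag [continuous_intros]:
  fixes f :: "'a::topological_space \<Rightarrow> real^'n^'n" and g :: "'a \<Rightarrow> real^'m^'m"
  assumes "continuous_on S f" "continuous_on S g"
  shows "continuous_on S (\<lambda>x. f x \<oplus>\<^sub>d g x)"
  unfolding block_diag_def
proof (intro continuous_on_vec_lambda)
  show "continuous_on S (\<lambda>x. case (i, j) of (Inl a, Inl b) \<Rightarrow> f x $ a $ b | (Inr a, Inr b) \<Rightarrow> g x $ a $ b | _ \<Rightarrow> 0)"
    for i j :: "'n + 'm"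
    by (cases i; cases j) (auto intro!: continuous_intros assms)
qed

text \<open>The one-block identity is applied to the second block with the first fixed in the
  simplex group, then to the first block with the second fixed in the orthogonal group.\<close>

lemma simplex_average_pair_eq_integral:
  fixes f :: "real^('n::finite + 'n)^('n + 'n) \<Rightarrow> real"
  assumes V: "regular_simplex_vertices V" and haar: "haar_orthogonal \<mu>"
    and cont: "continuous_on UNIV f" and inv: "third_turn_invariant f"
  shows "measure_pmf.expectation
           (pair_pmf (pmf_of_set (simplex_group V)) (pmf_of_set (simplex_group V)))
           (\<lambda>(P, S). f (P \<oplus>\<^sub>d S))
       = (\<integral>(Q, R). f (Q \<oplus>\<^sub>d R) \<partial>(\<mu> \<Otimes>\<^sub>M \<mu>))"
proof -
  let ?G = "simplex_group V"
  have G: "finite ?G" "?G \<noteq> {}" "?G \<subseteq> orthogonal_group"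
    using finite_simplex_group[OF V] simplex_group_mat_1 by (auto simp: simplex_group_def)
  interpret prob_space \<mu>
    using haar by (simp add: haar_orthogonal_def)
  interpret pair: pair_prob_space \<mu> \<mu> ..
  have space: "space \<mu> = orthogonal_group"
    using haar by (simp add: haar_orthogonal_def)
  have cont_left: "continuous_on UNIV (\<lambda>Q. f (Q \<oplus>\<^sub>d R))"
    and cont_right: "continuous_on UNIV (\<lambda>Q. f (R \<oplus>\<^sub>d Q))" for R :: "real^'n^'n"
    by (intro continuous_on_compose2[OF cont] continuous_intros; simp)+
  have cont_pair: "continuous_on S (\<lambda>(Q, R). f (Q \<oplus>\<^sub>d R))" for S :: "((real^'n^'n) \<times> (real^'n^'n)) set"
    unfolding split_beta by (intro continuous_on_compose2[OF cont] continuous_intros) simp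
  have "bounded ((\<lambda>(Q, R). f (Q \<oplus>\<^sub>d R)) ` (orthogonal_group \<times> (orthogonal_group :: (real^'n^'n) set)))"
    by (intro compact_imp_bounded compact_continuous_image cont_pair compact_Times compact_orthogonal_group)
  then obtain B where B: "\<And>Q R :: real^'n^'n. Q \<in> orthogonal_group \<Longrightarrow> R \<in> orthogonal_group \<Longrightarrow> \<bar>f (Q \<oplus>\<^sub>d R)\<bar> \<le> B"
    unfolding bounded_iff by fastforce
  have id: "(\<lambda>Q. Q) \<in> borel_measurable \<mu>"
    by (rule measurable_id_haar[OF haar])
  have "(\<lambda>p. (fst p, snd p)) \<in> borel_measurable (\<mu> \<Otimes>\<^sub>M \<mu>)"
    using measurable_compose[OF measurable_fst id] measurable_compose[OF measurable_snd id]
    by (rule borel_measurable_Pair)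
  then have "(\<lambda>(Q, R). f (Q \<oplus>\<^sub>d R)) \<in> borel_measurable (\<mu> \<Otimes>\<^sub>M \<mu>)"
    using measurable_compose[OF _ borel_measurable_continuous_onI[OF cont_pair]] by simp
  then have integrable: "integrable (\<mu> \<Otimes>\<^sub>M \<mu>) (\<lambda>(Q, R). f (Q \<oplus>\<^sub>d R))"
    using B by (intro pair.P.integrable_const_bound[of _ B] AE_I2) (auto simp: space_pair_measure space)
  have integrable_right: "integrable \<mu> (\<lambda>R. f (P \<oplus>\<^sub>d R))" if "P \<in> orthogonal_group" for P
    using B that measurable_compose[OF id borel_measurable_continuous_onI[OF cont_right]]
    by (intro integrable_const_bound[of _ B] AE_I2) (auto simp: space)
  have "measure_pmf.expectation (pair_pmf (pmf_of_set ?G) (pmf_of_set ?G)) (\<lambda>(P, S). f (P \<oplus>\<^sub>d S))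
      = (\<Sum>p\<in>?G \<times> ?G. (\<lambda>(P, S). f (P \<oplus>\<^sub>d S)) p * pmf (pair_pmf (pmf_of_set ?G) (pmf_of_set ?G)) p)"
    using G by (intro integral_measure_pmf_real) auto
  \<comment> \<open>By independence and uniformity every pair has the same weight.\<close>
  also have "\<dots> = (\<Sum>P\<in>?G. \<Sum>S\<in>?G. f (P \<oplus>\<^sub>d S) * (1 / card ?G * (1 / card ?G)))"
    unfolding sum.cartesian_product
    by (intro sum.cong) (auto simp: pmf_pair pmf_of_set[OF G(2,1)])
  also have "\<dots> = (\<Sum>P\<in>?G. (\<Sum>S\<in>?G. f (P \<oplus>\<^sub>d S)) / card ?G) / card ?G"
    by (simp add: sum_divide_distrib)
  also have "\<dots> = (\<Sum>P\<in>?G. \<integral>R. f (P \<oplus>\<^sub>d R) \<partial>\<mu>) / card ?G"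
    using G simplex_average_eq_integral[OF V haar cont_right third_turn_invariant_block_right[OF inv]]
    by (metis (no_types, lifting) subsetD sum.cong)
  \<comment> \<open>The finite average over P moves under the integral, so that the first block can
    be averaged for each fixed R.\<close>
  also have "\<dots> = (\<integral>R. (\<Sum>P\<in>?G. f (P \<oplus>\<^sub>d R)) / card ?G \<partial>\<mu>)"
    using integrable_right G by (subst Bochner_Integration.integral_sum[symmetric]) auto
  also have "\<dots> = (\<integral>R. (\<integral>Q. f (Q \<oplus>\<^sub>d R) \<partial>\<mu>) \<partial>\<mu>)"
    using simplex_average_eq_integral[OF V haar cont_left third_turn_invariant_block_left[OF inv]]
    by (intro Bochner_Integration.integral_cong) (auto simp: space)
  \<comment> \<open>Fubini, justified by the boundedness of f on the compact set of block
    pairs.\<close>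
  also have "\<dots> = (\<integral>(Q, R). f (Q \<oplus>\<^sub>d R) \<partial>(\<mu> \<Otimes>\<^sub>M \<mu>))"
    using pair.integral_snd[of "\<lambda>Q R. f (Q \<oplus>\<^sub>d R)"] integrable by simp
  finally show ?thesis .
qed

theorem theorem4p11:
  fixes C D :: "real^('n::finite + 'n)^('n + 'n)"
    and V :: "(real^'n) set"
    and \<mu> :: "(real^'n^'n) measure"
    and x :: real
  assumes "transpose C = C"
    and "transpose D = D"
    and "regular_simplex_vertices V"
    and "haar_orthogonal \<mu>"
  shows "measure_pmf.expectation
           (pair_pmf (pmf_of_set (simplex_group V)) (pmf_of_set (simplex_group V)))
           (\<lambda>(P, S). det (x *\<^sub>R mat 1 - C - (P \<oplus>\<^sub>d S) ** D ** transpose (P \<oplus>\<^sub>d S)))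
       = (\<integral>(Q, R). det (x *\<^sub>R mat 1 - C - (Q \<oplus>\<^sub>d R) ** D ** transpose (Q \<oplus>\<^sub>d R))
            \<partial>(\<mu> \<Otimes>\<^sub>M \<mu>))"
proof (rule simplex_average_pair_eq_integral[OF assms(3,4)])
  \<comment> \<open>The determinant is treated as a function of the whole block matrix M, with
    \<open>x *\<^sub>R mat 1 - C\<close> in the role of A.\<close>
  show "continuous_on UNIV (\<lambda>M. det (x *\<^sub>R mat 1 - C - M ** D ** transpose M))"
    by (intro continuous_intros)
qed (rule third_turn_invariant_det)

end
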